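(* Let $p$ be an odd prime and $x$ a rational number with denominator not divisible by $p$, such that $x\not\equiv0,1\pmod p$. (i) If $p\equiv1\pmod 4$, then $$\sum_{k=0}^{[p/4]}\binom{4k}{2k}\Big(\frac x{16}\Big)^k\equiv x^{\frac{p-1}4}\sum_{k=0}^{[p/4]}\binom{4k}{2k}\frac1{(16x)^k}\pmod p.$$ (ii) If $p\equiv3\pmod 4$, then $$\sum_{k=0}^{[p/4]}\binom{4k}{2k}\frac1{(16x)^k}\equiv\Big(1-\frac1x\Big)^{\frac{p-3}4}\sum_{k=0}^{[p/4]}\binom{4k}{2k}\frac1{(16(1-x))^k}\pmod p.$$
   Context: $[x]$ is the greatest integer not exceeding $x$. Congruences mod $p$ are taken in the ring of rationals with denominator prime to $p$. *)

theory Defs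
  imports Complex_Main "HOL-Computational_Algebra.Primes"
begin

definition p_integers :: "nat \<Rightarrow> rat set" where
  "p_integers p = {x. \<not> int p dvd snd (quotient_of x)}"

text \<open>Both sides are required to lie in the ring of \<open>p\<close>-integral rationals, so a
  congruence also asserts that they are \<open>p\<close>-integral.\<close>

definition rat_cong :: "rat \<Rightarrow> rat \<Rightarrow> nat \<Rightarrow> bool" where
  "rat_cong a b p \<longleftrightarrow>
     a \<in> p_integers p \<and> b \<in> p_integers p \<and> (\<exists>c \<in> p_integers p. a - b = of_nat p * c)"

end

theory Submission
  imports Defs "HOL-Number_Theory.Cong"
begin

text \<open>
  Put \<open>m = (p - 1) / 2\<close>. As \<open>m\<close> is \<open>-1/2\<close> modulo \<open>p\<close>, the coefficient
  \<open>binom(4k, 2k) / 16^k = binom(-1/2, 2k)\<close> is congruent to \<open>binom(m, 2k)\<close>. If \<open>m = 2n\<close>,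
  part (i) is the symmetry \<open>binom(2n, 2k) = binom(2n, 2n - 2k)\<close>. If \<open>m = 2n + 1\<close>, then
  \<open>n\<close> is \<open>-3/4\<close> modulo \<open>p\<close>, which makes \<open>binom(m, 2j)\<close> congruent to
  \<open>(-4)^j binom(n + j, 2j)\<close>; these are the coefficients of \<open>cos (m \<theta>) / cos \<theta>\<close> as a polynomial in
  \<open>y = sin\<^sup>2 \<theta>\<close>, and expanding the same function by de Moivre's formula gives the right-hand
  side of (ii) at \<open>x = 1 / y\<close>.
\<close>

section \<open>Arithmetic of p-integral rationals and their congruences\<close>

text \<open>Membership can be tested on an unreduced fraction: cross-multiplication and coprimality
  make the reduced denominator \<open>d\<close> a divisor of \<open>b\<close>.\<close>

lemma p_integersI:
  assumes "\<not> int p dvd b"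
  shows "of_int a / of_int b \<in> p_integers p"
proof -
  obtain c d where q: "quotient_of (of_int a / of_int b) = (c, d)"
    by fastforce
  have d: "d > 0" "coprime c d"
    using quotient_of_denom_pos[OF q] quotient_of_coprime[OF q] by auto
  have b: "b \<noteq> 0" using assms by auto
  have "(of_int a / of_int b :: rat) = of_int c / of_int d"
    using quotient_of_div[OF q] .
  hence "(of_int (a * d) :: rat) = of_int (c * b)"
    using b d by (simp add: field_simps)
  hence "a * d = c * b" by (simp only: of_int_eq_iff)
  hence "d dvd c * b" by (metis dvd_triv_right)
  hence "d dvd b" using d by (simp add: coprime_commute coprime_dvd_mult_right_iff)
  hence "\<not> int p dvd d" using assms dvd_trans by blast
  thus ?thesis by (simp add: p_integers_def q)
qed

lemma p_integersE:
  assumes "x \<in> p_integers p"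
  obtains a b where "\<not> int p dvd b" "b \<noteq> 0" "x = of_int a / of_int b"
proof -
  obtain a b where q: "quotient_of x = (a, b)" by fastforce
  moreover have "\<not> int p dvd b" using assms q by (simp add: p_integers_def)
  moreover from this have "b \<noteq> 0" by auto
  ultimately show ?thesis using that quotient_of_div[OF q] by blast
qed

context
  fixes p :: nat
  assumes p: "prime p"
begin

lemma p_integers_of_int [simp]: "of_int a \<in> p_integers p"
  using p_integersI[of p 1 a] p by (auto simp: prime_nat_iff)

lemma p_integers_1 [simp]: "1 \<in> p_integers p"
  using p_integers_of_int[of 1] by simp

lemma p_integers_0 [simp]: "0 \<in> p_integers p"
  using p_integers_of_int[of 0] by simp

lemma p_integers_add:
  assumes "x \<in> p_integers p" "y \<in> p_integers p"
  shows "x + y \<in> p_integers p"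
proof -
  obtain a b where 1: "\<not> int p dvd b" "b \<noteq> 0" "x = of_int a / of_int b"
    using p_integersE assms(1) by blast
  obtain c d where 2: "\<not> int p dvd d" "d \<noteq> 0" "y = of_int c / of_int d"
    using p_integersE assms(2) by blast
  have "x + y = of_int (a * d + c * b) / of_int (b * d)"
    using 1 2 by (simp add: field_simps)
  moreover have "\<not> int p dvd b * d" using 1 2 p by (simp add: prime_dvd_mult_iff)
  ultimately show ?thesis using p_integersI by metis
qed

lemma p_integers_mult:
  assumes "x \<in> p_integers p" "y \<in> p_integers p"
  shows "x * y \<in> p_integers p"
proof -
  obtain a b where 1: "\<not> int p dvd b" "b \<noteq> 0" "x = of_int a / of_int b"
    using p_integersE assms(1) by blast
  obtain c d where 2: "\<not> int p dvd d" "d \<noteq> 0" "y = of_int c / of_int d"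
    using p_integersE assms(2) by blast
  have "x * y = of_int (a * c) / of_int (b * d)"
    using 1 2 by (simp add: field_simps)
  moreover have "\<not> int p dvd b * d" using 1 2 p by (simp add: prime_dvd_mult_iff)
  ultimately show ?thesis using p_integersI by metis
qed

lemma p_integers_diff:
  assumes "x \<in> p_integers p" "y \<in> p_integers p"
  shows "x - y \<in> p_integers p"
  using p_integers_add[OF assms(1) p_integers_mult[OF p_integers_of_int[of "-1"] assms(2)]]
  by simp

lemma p_integers_power: "x \<in> p_integers p \<Longrightarrow> x ^ k \<in> p_integers p"
  by (induction k) (simp_all add: p_integers_mult)

text \<open>If \<open>p\<close> divided the numerator of \<open>x\<close>, then \<open>x\<close>
  would be congruent to 0; so the reciprocal fraction again has a denominator prime to
  \<open>p\<close>.\<close>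

lemma p_integers_inverse:
  assumes "x \<in> p_integers p" "\<not> rat_cong x 0 p"
  shows "inverse x \<in> p_integers p"
proof -
  obtain a b where 1: "\<not> int p dvd b" "b \<noteq> 0" "x = of_int a / of_int b"
    using p_integersE assms(1) by blast
  have "\<not> int p dvd a"
  proof
    assume "int p dvd a"
    then obtain c where c: "a = int p * c" by blast
    have "x - 0 = of_nat p * (of_int c / of_int b)" using 1 c by simp
    hence "rat_cong x 0 p"
      using assms(1) p_integersI[OF 1(1), of c] p_integers_0 unfolding rat_cong_def by blast
    thus False using assms(2) by blast
  qed
  from p_integersI[OF this, of b] show ?thesis using 1 by simp
qed

lemma rat_cong_refl: "x \<in> p_integers p \<Longrightarrow> rat_cong x x p"
  unfolding rat_cong_def by (auto intro: bexI[of _ 0])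

lemma rat_cong_sym:
  assumes "rat_cong x y p"
  shows "rat_cong y x p"
proof -
  obtain c where c: "c \<in> p_integers p" "x - y = of_nat p * c"
    using assms by (auto simp: rat_cong_def)
  have "y - x = of_nat p * (0 - c)" using c(2) by simp
  moreover have "0 - c \<in> p_integers p" using c by (intro p_integers_diff) auto
  ultimately show ?thesis using assms unfolding rat_cong_def by blast
qed

lemma rat_cong_add:
  assumes "rat_cong a b p" "rat_cong c d p"
  shows "rat_cong (a + c) (b + d) p"
proof -
  obtain u v where u: "u \<in> p_integers p" "a - b = of_nat p * u"
    and v: "v \<in> p_integers p" "c - d = of_nat p * v"
    using assms by (auto simp: rat_cong_def)
  have "(a + c) - (b + d) = of_nat p * (u + v)" using u v by (simp add: algebra_simps)
  thus ?thesis using assms u v p_integers_add unfolding rat_cong_def by blast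
qed

lemma rat_cong_trans:
  assumes "rat_cong a b p" "rat_cong b c p"
  shows "rat_cong a c p"
proof -
  obtain u v where u: "u \<in> p_integers p" "a - b = of_nat p * u"
    and v: "v \<in> p_integers p" "b - c = of_nat p * v"
    using assms by (auto simp: rat_cong_def)
  have "a - c = of_nat p * (u + v)" using u v by (simp add: algebra_simps)
  thus ?thesis using assms u v p_integers_add unfolding rat_cong_def by blast
qed

lemma rat_cong_mult_right:
  assumes "rat_cong a b p" "c \<in> p_integers p"
  shows "rat_cong (a * c) (b * c) p"
proof -
  obtain u where u: "u \<in> p_integers p" "a - b = of_nat p * u"
    using assms by (auto simp: rat_cong_def)
  have "a * c - b * c = of_nat p * (u * c)" using u by (simp add: algebra_simps)
  thus ?thesis using assms u p_integers_mult unfolding rat_cong_def by blast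
qed

lemma rat_cong_sum:
  assumes "\<And>i. i \<in> A \<Longrightarrow> rat_cong (f i) (g i) p"
  shows "rat_cong (sum f A) (sum g A) p"
  using assms
  by (induction A rule: infinite_finite_induct) (auto intro: rat_cong_add rat_cong_refl)

lemma rat_cong_of_int:
  assumes "[a = b] (mod int p)"
  shows "rat_cong (of_int a) (of_int b) p"
proof -
  obtain c where "a - b = int p * c" 
    using assms by (auto simp: cong_iff_dvd_diff)
  hence "(of_int a - of_int b :: rat) = of_nat p * of_int c"
    by (metis of_int_diff of_int_mult of_int_of_nat_eq)
  thus ?thesis unfolding rat_cong_def by auto
qed

text \<open>All factors of \<open>r!\<close> are below the prime \<open>p\<close>, so
  \<open>r!\<close> is a unit mod \<open>p\<close>. Congruences of binomial coefficients can thus be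
  checked on the products in their numerators.\<close>

lemma cong_cancel_fact:
  assumes "[fact r * a = fact r * (b::int)] (mod int p)" "r < p"
  shows "[a = b] (mod int p)"
proof -
  have "\<not> p dvd fact r" using assms(2) p by (simp add: prime_dvd_fact_iff)
  hence "coprime p (fact r)" using p prime_imp_coprime by blast
  hence "coprime (int (fact r)) (int p)" by (simp only: coprime_int_iff coprime_commute)
  thus ?thesis using assms(1) by (simp add: cong_mult_lcancel)
qed

end

section \<open>Product formulas for binomial coefficients\<close>

text \<open>The falling factorial is taken over the integers, so there is no truncated subtraction;
  for \<open>r > m\<close> the factor at \<open>i = m\<close> is 0, in agreement with the vanishing
  binomial.\<close>

lemma fact_binomial_eq_prod:
  "fact r * int (m choose r) = (\<Prod>i<r. int m - int i)"
proof (induction r)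
  case (Suc r)
  have "Suc r * (m choose Suc r) = (m - r) * (m choose r)"
    by (metis binomial_absorb_comp binomial_absorption mult.commute)
  hence "int (Suc r) * int (m choose Suc r) = int (m - r) * int (m choose r)"
    by (metis of_nat_mult)
  also have "\<dots> = (int m - int r) * int (m choose r)"
    by (cases "r \<le> m") (auto simp: binomial_eq_0 of_nat_diff)
  finally have "fact (Suc r) * int (m choose Suc r) = fact r * ((int m - int r) * int (m choose r))"
    by (metis fact_Suc mult.assoc mult.commute of_nat_fact of_nat_mult)
  also have "\<dots> = (int m - int r) * (fact r * int (m choose r))"
    by (simp only: ac_simps)
  finally show ?case unfolding Suc by (simp add: mult.commute)
qed simp

lemma fact_central_binomial_eq_prod:
  "fact r * int ((2 * r) choose r) = 2 ^ r * (\<Prod>i<r. 2 * int i + 1)"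
proof (induction r)
  case (Suc r)
  have "Suc r * ((2 * Suc r) choose Suc r) = 2 * (2 * r + 1) * ((2 * r) choose r)"
  proof -
    have 1: "Suc r * ((2 * Suc r) choose Suc r) = (2 * Suc r) * (Suc (2 * r) choose r)"
      using Suc_times_binomial_eq[of "Suc (2 * r)" r] by (simp add: mult.commute)
    \<comment> \<open>The two middle entries of row \<open>2 * r + 1\<close> agree, which allows
      absorption a second time.\<close>
    have "Suc (2 * r) choose r = Suc (2 * r) choose Suc r"
      by (subst binomial_symmetric) auto
    hence "Suc r * (Suc (2 * r) choose r) = Suc (2 * r) * ((2 * r) choose r)"
      using Suc_times_binomial_eq[of "2 * r" r] by (simp add: mult.commute)
    thus ?thesis using 1 by (simp add: algebra_simps)
  qed
  hence "int (Suc r) * int ((2 * Suc r) choose Suc r) = 2 * (2 * int r + 1) * int ((2 * r) choose r)"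
    by (metis (no_types) of_nat_mult of_nat_numeral of_nat_add of_nat_1)
  hence "fact (Suc r) * int ((2 * Suc r) choose Suc r)
      = fact r * (2 * (2 * int r + 1) * int ((2 * r) choose r))"
    by (metis fact_Suc mult.assoc mult.commute of_nat_fact of_nat_mult)
  also have "\<dots> = 2 * (2 * int r + 1) * (fact r * int ((2 * r) choose r))"
    by (simp add: algebra_simps)
  finally show ?case unfolding Suc by (simp add: algebra_simps)
qed simp

text \<open>The falling product runs from \<open>n + j\<close> down to \<open>n - j + 1\<close>;
  raising \<open>j\<close> by one adds \<open>n + j + 1\<close> at the top and \<open>n - j\<close>
  at the bottom, and these two factors form one pair.\<close>

lemma fact_binomial_centered_eq_prod:
  "fact (2 * j) * int ((n + j) choose (2 * j)) = (\<Prod>i<j. (int n + 1 + int i) * (int n - int i))"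
proof -
  have "(\<Prod>i<2 * j. int (n + j) - int i) = (\<Prod>i<j. (int n + 1 + int i) * (int n - int i))"
  proof (induction j)
    case (Suc j)
    have "(\<Prod>i<2 * Suc j. int (n + Suc j) - int i)
        = (\<Prod>i<Suc (Suc (2 * j)). int (n + Suc j) - int i)" by simp
    also have "\<dots> = (int n + int j + 1) * (\<Prod>i<Suc (2 * j). int (n + j) - int i)"
      by (subst prod.lessThan_Suc_shift) (simp add: algebra_simps)
    also have "\<dots> = (int n + int j + 1) * (int n - int j) * (\<Prod>i<2 * j. int (n + j) - int i)"
      by (simp add: algebra_simps)
    finally show ?case using Suc by (simp add: algebra_simps)
  qed simp
  thus ?thesis using fact_binomial_eq_prod[of "2 * j" "n + j"] by simp
qed

lemma prod_lessThan_double: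
  "(\<Prod>i<2 * j. f (i::nat)) = (\<Prod>i<j. f (2 * i) * f (2 * i + 1) :: 'a :: comm_monoid_mult)"
  by (induction j) (simp_all add: mult.assoc)

section \<open>Congruences between binomial coefficients\<close>

text \<open>The congruence holds factor by factor: \<open>2 i + 1\<close> and
  \<open>-2 (m - i)\<close> differ by exactly \<open>2 m + 1 = p\<close>.\<close>

lemma central_binomial_cong:
  assumes p: "prime p" and m: "p = 2 * m + 1" and "r < p"
  shows "[int ((2 * r) choose r) = (-4) ^ r * int (m choose r)] (mod int p)"
proof (rule cong_cancel_fact[OF p _ \<open>r < p\<close>])
  have "fact r * ((-4) ^ r * int (m choose r)) = (-4) ^ r * (\<Prod>i<r. int m - int i)"
    using fact_binomial_eq_prod[of r m] by (simp add: algebra_simps)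
  \<comment> \<open>The power \<open>2 ^ r\<close> matches the one in the central binomial product;
    \<open>(-2) ^ r\<close> is spread over the \<open>r\<close> factors.\<close>
  also have "\<dots> = 2 ^ r * (-2) ^ r * (\<Prod>i<r. int m - int i)"
    by (simp flip: power_mult_distrib)
  also have "\<dots> = 2 ^ r * (\<Prod>i<r. -2 * (int m - int i))"
    by (simp only: prod.distrib prod_constant card_lessThan mult.assoc)
  finally have *: "fact r * ((-4) ^ r * int (m choose r)) = 2 ^ r * (\<Prod>i<r. -2 * (int m - int i))" .
  have "[2 * int i + 1 = -2 * (int m - int i)] (mod int p)" for i
    unfolding cong_iff_dvd_diff m by (rule dvdI[of _ _ 1]) simp
  thus "[fact r * int ((2 * r) choose r) = fact r * ((-4) ^ r * int (m choose r))] (mod int p)"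
    unfolding * fact_central_binomial_eq_prod
    by (intro cong_mult cong_prod cong_refl) auto
qed

text \<open>Grouping the \<open>2 j\<close> falling factors in pairs reduces the claim to
  \<open>2 n + 1 - 2 i\<close> being congruent to \<open>-2 (n + 1 + i)\<close>, since the two
  differ by \<open>4 n + 3 = p\<close>.\<close>

lemma binomial_centered_cong:
  assumes p: "prime p" and n: "p = 4 * n + 3" and "2 * j < p"
  shows "[int ((2 * n + 1) choose (2 * j)) = (-4) ^ j * int ((n + j) choose (2 * j))] (mod int p)"
proof -
  \<comment> \<open>Both sides are compared after multiplication by \<open>4 ^ j\<close>, a unit mod
    the odd prime \<open>p\<close>.\<close>
  have eq1: "4 ^ j * (fact (2 * j) * int ((2 * n + 1) choose (2 * j)))
      = (\<Prod>i<j. 4 * ((2 * int n + 1 - 2 * int i) * (2 * int n - 2 * int i)))"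
    unfolding fact_binomial_eq_prod prod_lessThan_double
    by (simp add: prod.distrib diff_diff_eq add.commute)
  have "(4::int) ^ j * (-4) ^ j = (-16) ^ j" by (simp flip: power_mult_distrib)
  moreover have "4 ^ j * (fact (2 * j) * ((-4) ^ j * int ((n + j) choose (2 * j))))
      = 4 ^ j * (-4) ^ j * (fact (2 * j) * int ((n + j) choose (2 * j)))"
    by (simp only: ac_simps)
  ultimately have eq2: "4 ^ j * (fact (2 * j) * ((-4) ^ j * int ((n + j) choose (2 * j))))
      = (\<Prod>i<j. - 16 * ((int n + 1 + int i) * (int n - int i)))"
    unfolding fact_binomial_centered_eq_prod
    by (simp only: prod.distrib prod_constant card_lessThan)
  have "[4 * ((2 * int n + 1 - 2 * int i) * (2 * int n - 2 * int i))
      = - 16 * ((int n + 1 + int i) * (int n - int i))] (mod int p)" for i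
    unfolding cong_iff_dvd_diff n
    \<comment> \<open>The difference is \<open>8 (n - i) ((2 n + 1 - 2 i) + 2 (n + 1 + i))\<close>,
      whose last factor is \<open>4 n + 3\<close>.\<close>
    by (rule dvdI[of _ _ "8 * (int n - int i)"]) (simp add: algebra_simps)
  hence "[4 ^ j * (fact (2 * j) * int ((2 * n + 1) choose (2 * j)))
      = 4 ^ j * (fact (2 * j) * ((-4) ^ j * int ((n + j) choose (2 * j))))] (mod int p)"
    unfolding eq1 eq2 by (intro cong_prod)
  moreover have "coprime (4 ^ j) (int p)"
  proof -
    have "coprime (2::int) (int p)" unfolding n by simp
    hence "coprime (2 ^ (2 * j)) (int p)" by simp
    thus ?thesis by (simp add: power_mult)
  qed
  ultimately show ?thesis
    using cong_cancel_fact[OF p _ assms(3)] by (simp add: cong_mult_lcancel)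
qed

section \<open>Two expansions of a sum of odd powers\<close>

text \<open>Pascal's rule couples these sums to companion sums with odd lower index, and the closed
  forms of both obey the same recurrences. Keeping \<open>z + z'\<close> as a factor avoids
  division, so any commutative ring will do.\<close>

lemma odd_power_sum_eq_centered_binomials:
  fixes z z' :: "'a :: comm_ring_1"
  assumes zz: "z * z' = 1"
  shows "(z + z') * (\<Sum>j\<le>n. of_nat ((n + j) choose (2 * j)) * (z - z') ^ (2 * j))
           = z ^ (2 * n + 1) + z' ^ (2 * n + 1)"
proof -
  \<comment> \<open>For \<open>z = exp (i theta)\<close> and \<open>z'\<close> its inverse,
    \<open>S n\<close> is \<open>cos ((2 n + 1) theta) / cos theta\<close> and \<open>T n\<close> is
    \<open>sin ((2 n + 2) theta) / sin (2 theta)\<close>.\<close>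
  define v where "v = (z - z') ^ 2"
  define S where "S n = (\<Sum>j\<le>n. of_nat ((n + j) choose (2 * j)) * v ^ j)" for n
  define T where "T n = (\<Sum>j\<le>n. of_nat ((n + j + 1) choose (2 * j + 1)) * v ^ j)" for n
  have S: "S (Suc n) = S n + v * T n" for n
  proof -
    have "S (Suc n) = 1 + (\<Sum>j\<le>n. of_nat (Suc (Suc (n + j)) choose (Suc (Suc (2 * j)))) * v ^ Suc j)"
      unfolding S_def by (subst sum.atMost_Suc_shift) simp
    also have "\<dots> = 1 + (\<Sum>j\<le>n. of_nat (Suc (n + j) choose (Suc (Suc (2 * j)))) * v ^ Suc j) + v * T n"
      unfolding T_def sum_distrib_left add.assoc sum.distrib[symmetric]
      by (simp add: distrib_left distrib_right ac_simps)
    also have "1 + (\<Sum>j\<le>n. of_nat (Suc (n + j) choose (Suc (Suc (2 * j)))) * v ^ Suc j)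
        = (\<Sum>j\<le>Suc n. of_nat ((n + j) choose (2 * j)) * v ^ j)"
      by (subst sum.atMost_Suc_shift) simp
    \<comment> \<open>The extra term \<open>j = n + 1\<close> vanishes, being
      \<open>(2 n + 1) choose (2 n + 2)\<close>.\<close>
    also have "\<dots> = S n" unfolding S_def by (simp add: binomial_eq_0)
    finally show ?thesis .
  qed
  have T: "T (Suc n) = T n + S (Suc n)" for n
  proof -
    have "T (Suc n) = (\<Sum>j\<le>Suc n. of_nat ((n + j + 1) choose (2 * j + 1)) * v ^ j) + S (Suc n)"
      unfolding T_def S_def sum.distrib[symmetric]
      by (intro sum.cong refl) (simp add: distrib_left distrib_right)
    also have "(\<Sum>j\<le>Suc n. of_nat ((n + j + 1) choose (2 * j + 1)) * v ^ j) = T n"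
      unfolding T_def by (simp add: binomial_eq_0)
    finally show ?thesis .
  qed
  \<comment> \<open>The two closed forms are proved together: \<open>S (Suc n)\<close> needs
    \<open>T n\<close>, and \<open>T (Suc n)\<close> needs \<open>S (Suc n)\<close>.\<close>
  have "(z + z') * S n = z ^ (2 * n + 1) + z' ^ (2 * n + 1) \<and>
        (z ^ 2 - z' ^ 2) * T n = z ^ (2 * n + 2) - z' ^ (2 * n + 2)"
  proof (induction n)
    case 0
    show ?case by (simp add: S_def T_def power2_eq_square)
  next
    case (Suc n)
    define a where "a = z ^ (2 * n + 1)"
    define b where "b = z' ^ (2 * n + 1)"
    have pw: "z ^ (2 * n + 2) = z * a" "z' ^ (2 * n + 2) = z' * b"
      "z ^ (2 * Suc n + 1) = z * z * a" "z' ^ (2 * Suc n + 1) = z' * z' * b"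
      "z ^ (2 * Suc n + 2) = z * z * z * a" "z' ^ (2 * Suc n + 2) = z' * z' * z' * b"
      by (simp_all add: a_def b_def algebra_simps)
    have IH: "(z + z') * S n = a + b" "(z ^ 2 - z' ^ 2) * T n = z * a - z' * b"
      using Suc unfolding pw by (simp_all add: a_def b_def)
    have "(z + z') * S (Suc n) = (z + z') * S n + (z - z') * ((z ^ 2 - z' ^ 2) * T n)"
      unfolding S v_def by (simp add: algebra_simps power2_eq_square)
    \<comment> \<open>The products \<open>z * z'\<close> are isolated so that replacing them by 1
      cancels \<open>a + b\<close>.\<close>
    also have "\<dots> = a + b + (z * z * a + z' * z' * b - (z * z') * a - (z * z') * b)"
      unfolding IH by (simp add: algebra_simps)
    finally have 1: "(z + z') * S (Suc n) = z * z * a + z' * z' * b"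
      unfolding zz by simp
    have "(z ^ 2 - z' ^ 2) * T (Suc n) = (z ^ 2 - z' ^ 2) * T n + (z - z') * ((z + z') * S (Suc n))"
      unfolding T by (simp add: algebra_simps power2_eq_square)
    also have "\<dots> = z * a - z' * b + (z * z * z * a - z' * z' * z' * b - (z * z') * (z * a) + (z * z') * (z' * b))"
      unfolding IH 1 by (simp add: algebra_simps)
    finally have "(z ^ 2 - z' ^ 2) * T (Suc n) = z * z * z * a - z' * z' * z' * b"
      unfolding zz by simp
    with 1 show ?case unfolding pw by simp
  qed
  thus ?thesis
    unfolding S_def v_def power_mult by auto
qed

text \<open>Odd powers of \<open>b\<close> cancel and even ones double; each surviving term has an
  odd power of \<open>a\<close>, so one \<open>a\<close> factors out and only squares
  remain.\<close>

lemma odd_power_sum_binomial: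
  fixes a b :: "'a :: comm_ring_1"
  shows "(a + b) ^ (2 * n + 1) + (a - b) ^ (2 * n + 1)
    = 2 * a * (\<Sum>k\<le>n. of_nat ((2 * n + 1) choose (2 * k)) * (b ^ 2) ^ k * (a ^ 2) ^ (n - k))"
proof -
  \<comment> \<open>The \<open>2 n + 2\<close> binomial terms are paired by the parity of the
    exponent of \<open>c\<close>, which will be \<open>b\<close> and then
    \<open>- b\<close>.\<close>
  have *: "(c + a) ^ (2 * n + 1) = (\<Sum>k\<le>n.
      of_nat ((2 * n + 1) choose (2 * k)) * c ^ (2 * k) * a ^ (2 * n + 1 - 2 * k) +
      of_nat ((2 * n + 1) choose (2 * k + 1)) * c ^ (2 * k + 1) * a ^ (2 * n - 2 * k))" for c
    unfolding binomial_ring Suc_eq_plus1[symmetric] sum.in_pairs_0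
    by (simp del: binomial_Suc_Suc)
  have "(a + b) ^ (2 * n + 1) + (a - b) ^ (2 * n + 1) = (b + a) ^ (2 * n + 1) + (- b + a) ^ (2 * n + 1)"
    by (simp add: add.commute)
  also have "\<dots> = (\<Sum>k\<le>n. 2 * (of_nat ((2 * n + 1) choose (2 * k)) * b ^ (2 * k) * a ^ (2 * n + 1 - 2 * k)))"
    unfolding * sum.distrib[symmetric] by (intro sum.cong refl) simp
  also have "\<dots> = (\<Sum>k\<le>n. 2 * a * (of_nat ((2 * n + 1) choose (2 * k)) * (b ^ 2) ^ k * (a ^ 2) ^ (n - k)))"
  proof (intro sum.cong refl)
    fix k assume "k \<in> {..n}"
    hence "2 * n + 1 - 2 * k = Suc (2 * (n - k))" by auto
    hence "a ^ (2 * n + 1 - 2 * k) = a * (a ^ 2) ^ (n - k)" by (simp add: power_mult)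
    moreover have "b ^ (2 * k) = (b ^ 2) ^ k" by (rule power_mult)
    ultimately show "2 * (of_nat ((2 * n + 1) choose (2 * k)) * b ^ (2 * k) * a ^ (2 * n + 1 - 2 * k))
      = 2 * a * (of_nat ((2 * n + 1) choose (2 * k)) * (b ^ 2) ^ k * (a ^ 2) ^ (n - k))"
      by (simp add: mult_ac)
  qed
  finally show ?thesis by (simp only: sum_distrib_left)
qed

text \<open>This is \<open>cos ((2 n + 1) \<theta>) / cos \<theta>\<close> written in two ways as a polynomial in
  \<open>y = sin\<^sup>2 \<theta>\<close>.\<close>

lemma sum_even_binomials_eq:
  fixes y :: rat
  assumes "y \<noteq> 1"
  shows "(\<Sum>k\<le>n. of_nat ((2 * n + 1) choose (2 * k)) * (- y) ^ k * (1 - y) ^ (n - k))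
       = (\<Sum>j\<le>n. (-4) ^ j * of_nat ((n + j) choose (2 * j)) * y ^ j)"
proof -
  \<comment> \<open>Square roots of \<open>1 - y\<close> and \<open>- y\<close> are needed, hence
    the passage to complex numbers. Here \<open>w\<close> plays \<open>cos theta\<close> and
    \<open>d\<close> plays \<open>i sin theta\<close>, so \<open>w + d\<close> and
    \<open>w - d\<close> are mutually inverse.\<close>
  define Y :: complex where "Y = of_rat y"
  define w where "w = csqrt (1 - Y)"
  define d where "d = csqrt (- Y)"
  have w2: "w ^ 2 = 1 - Y" and d2: "d ^ 2 = - Y" by (simp_all add: w_def d_def)
  have w0: "w \<noteq> 0" using assms by (auto simp: w_def Y_def)
  have zz: "(w + d) * (w - d) = 1"
    using w2 d2 by (simp add: algebra_simps power2_eq_square)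
  have "2 * w * (\<Sum>k\<le>n. of_nat ((2 * n + 1) choose (2 * k)) * (- Y) ^ k * (1 - Y) ^ (n - k))
      = (w + d) ^ (2 * n + 1) + (w - d) ^ (2 * n + 1)"
    unfolding odd_power_sum_binomial w2 d2 ..
  also have "\<dots> = ((w + d) + (w - d)) *
      (\<Sum>j\<le>n. of_nat ((n + j) choose (2 * j)) * ((w + d) - (w - d)) ^ (2 * j))"
    using odd_power_sum_eq_centered_binomials[OF zz, of n] by (rule sym)
  also have "(w + d) + (w - d) = 2 * w" by simp
  also have "(w + d) - (w - d) = 2 * d" by simp
  finally have "2 * w * (\<Sum>k\<le>n. of_nat ((2 * n + 1) choose (2 * k)) * (- Y) ^ k * (1 - Y) ^ (n - k))
      = 2 * w * (\<Sum>j\<le>n. of_nat ((n + j) choose (2 * j)) * (2 * d) ^ (2 * j))" .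
  moreover have "of_nat ((n + j) choose (2 * j)) * (2 * d) ^ (2 * j)
      = (-4) ^ j * of_nat ((n + j) choose (2 * j)) * Y ^ j" for j
  proof -
    have "(2 * d) ^ 2 = -4 * Y" by (simp add: power_mult_distrib d2)
    hence "(2 * d) ^ (2 * j) = (-4) ^ j * Y ^ j" by (simp only: power_mult power_mult_distrib)
    thus ?thesis by simp
  qed
  ultimately have "2 * w * (\<Sum>k\<le>n. of_nat ((2 * n + 1) choose (2 * k)) * (- Y) ^ k * (1 - Y) ^ (n - k))
      = 2 * w * (\<Sum>j\<le>n. (-4) ^ j * of_nat ((n + j) choose (2 * j)) * Y ^ j)"
    by (simp only:)
  \<comment> \<open>Since \<open>y\<close> is not 1, \<open>2 * w\<close> is nonzero and cancels;
    what remains is free of square roots and descends to the rationals by injectivity of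
    \<open>of_rat\<close>.\<close>
  hence "(\<Sum>k\<le>n. of_nat ((2 * n + 1) choose (2 * k)) * (- Y) ^ k * (1 - Y) ^ (n - k))
      = (\<Sum>j\<le>n. (-4) ^ j * of_nat ((n + j) choose (2 * j)) * Y ^ j)"
    using w0 by (simp del: binomial_Suc_Suc)
  moreover have "\<dots> = of_rat (\<Sum>j\<le>n. (-4) ^ j * of_nat ((n + j) choose (2 * j)) * y ^ j)"
    by (simp add: Y_def of_rat_sum of_rat_mult of_rat_power of_rat_minus)
  moreover have "(\<Sum>k\<le>n. of_nat ((2 * n + 1) choose (2 * k)) * (- Y) ^ k * (1 - Y) ^ (n - k))
      = of_rat (\<Sum>k\<le>n. of_nat ((2 * n + 1) choose (2 * k)) * (- y) ^ k * (1 - y) ^ (n - k))"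
    by (simp add: Y_def of_rat_sum of_rat_mult of_rat_power of_rat_minus of_rat_diff
        del: binomial_Suc_Suc)
  ultimately show ?thesis by (simp only: of_rat_eq_iff)
qed

section \<open>Reduction of the sums mod p and the two congruences\<close>

text \<open>For \<open>r = 2 k\<close> the factor \<open>(-4) ^ r\<close> is \<open>16 ^ k\<close>,
  which the denominator \<open>16 ^ k\<close> removes; that denominator is prime to the odd
  \<open>p\<close>. The bound on \<open>N\<close> keeps \<open>2 k\<close> below
  \<open>p\<close>.\<close>

lemma central_binomial_sum_cong:
  assumes p: "prime p" and m: "p = 2 * m + 1" and N: "2 * N \<le> m" and y: "y \<in> p_integers p"
  shows "rat_cong (\<Sum>k\<le>N. of_nat ((4 * k) choose (2 * k)) * (y / 16) ^ k)
           (\<Sum>k\<le>N. of_nat (m choose (2 * k)) * y ^ k) p"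
proof (intro rat_cong_sum[OF p])
  fix k assume k: "k \<in> {..N}"
  have "odd (int p)" using m by simp
  hence "coprime 2 (int p)" by simp
  hence "coprime (2 ^ (4 * k)) (int p)" by simp
  moreover have "\<not> is_unit (int p)" using p by (auto simp: prime_nat_iff)
  ultimately have np: "\<not> int p dvd 2 ^ (4 * k)" 
    using coprime_common_divisor dvd_refl by blast
  have "(1 / 16 :: rat) ^ k = of_int 1 / of_int (2 ^ (4 * k))"
    by (simp add: power_mult power_divide)
  hence u: "(1 / 16 :: rat) ^ k \<in> p_integers p" using p_integersI[OF np, of 1] by simp
  have "2 * k < p" using k N m by auto
  from central_binomial_cong[OF p m this]
  have "[int ((4 * k) choose (2 * k)) = 16 ^ k * int (m choose (2 * k))] (mod int p)"
    by (simp add: power_mult)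
  from rat_cong_mult_right[OF p rat_cong_of_int[OF p this]
      p_integers_mult[OF p u p_integers_power[OF p y, of k]]]
  show "rat_cong (of_nat ((4 * k) choose (2 * k)) * (y / 16) ^ k) (of_nat (m choose (2 * k)) * y ^ k) p"
    by (simp add: power_divide mult_ac)
qed

theorem theorem2p2:
  fixes p :: nat and x :: rat
  assumes "prime p" and "odd p"
    and "x \<in> p_integers p"
    and "\<not> rat_cong x 0 p" and "\<not> rat_cong x 1 p"
  shows "(p mod 4 = 1 \<longrightarrow>
            rat_cong (\<Sum>k=0..p div 4. of_nat ((4 * k) choose (2 * k)) * (x / 16) ^ k)
                     (x ^ ((p - 1) div 4) *
                        (\<Sum>k=0..p div 4. of_nat ((4 * k) choose (2 * k)) * (1 / (16 * x) ^ k)))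
                     p) \<and>
         (p mod 4 = 3 \<longrightarrow>
            rat_cong (\<Sum>k=0..p div 4. of_nat ((4 * k) choose (2 * k)) * (1 / (16 * x) ^ k))
                     ((1 - 1 / x) ^ ((p - 3) div 4) *
                        (\<Sum>k=0..p div 4. of_nat ((4 * k) choose (2 * k)) * (1 / (16 * (1 - x)) ^ k)))
                     p)"
proof -
  note p = assms(1) and x = assms(3)
  note [trans] = rat_cong_trans[OF p]
  define y where "y = 1 / x"
  have y: "y \<in> p_integers p"
    using p_integers_inverse[OF p x assms(4)] by (simp add: y_def inverse_eq_divide)
  have x0: "x \<noteq> 0" using assms(4) rat_cong_refl[OF p p_integers_0[OF p]] by auto
  have x1: "x \<noteq> 1" using assms(5) rat_cong_refl[OF p p_integers_1[OF p]] by auto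
  \<comment> \<open>This puts the sums with \<open>x\<close> or \<open>1 - x\<close> in the
    denominator into the shape handled by \<open>central_binomial_sum_cong\<close>, at the
    reciprocal argument.\<close>
  have inv_eq: "1 / (16 * u) ^ k = ((1 / u) / 16) ^ k" for u :: rat and k
    by (simp add: power_divide power_mult_distrib)
  show ?thesis
  proof (intro conjI impI)
    assume "p mod 4 = 1"
    then obtain n where n: "p = 4 * n + 1" by (metis mult_div_mod_eq)
    hence m: "p = 2 * (2 * n) + 1" and dv: "p div 4 = n" "(p - 1) div 4 = n" by simp_all
    have "rat_cong (\<Sum>k\<le>n. of_nat ((4 * k) choose (2 * k)) * (x / 16) ^ k)
        (\<Sum>k\<le>n. of_nat ((2 * n) choose (2 * k)) * x ^ k) p"
      by (rule central_binomial_sum_cong[OF p m _ x]) simp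
    \<comment> \<open>Reversing the order of summation prepares for the symmetry of row
      \<open>2 * n\<close>, which preserves even positions.\<close>
    also have "(\<Sum>k\<le>n. of_nat ((2 * n) choose (2 * k)) * x ^ k)
        = (\<Sum>k\<le>n. of_nat ((2 * n) choose (2 * (n - k))) * x ^ (n - k))"
      by (rule sum.reindex_bij_witness[of _ "\<lambda>k. n - k" "\<lambda>k. n - k"]) auto
    also have "\<dots> = (\<Sum>k\<le>n. of_nat ((2 * n) choose (2 * k)) * y ^ k) * x ^ n"
      unfolding sum_distrib_right
    proof (intro sum.cong refl)
      fix k assume "k \<in> {..n}"
      hence k: "k \<le> n" by simp
      hence "(2 * n) choose (2 * (n - k)) = (2 * n) choose (2 * k)"
        using binomial_symmetric[of "2 * k" "2 * n"] by (simp add: diff_mult_distrib2)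
      moreover have "x ^ (n - k) = y ^ k * x ^ n"
        using k x0 by (simp add: y_def power_divide power_diff)
      ultimately show "of_nat ((2 * n) choose (2 * (n - k))) * x ^ (n - k)
          = of_nat ((2 * n) choose (2 * k)) * y ^ k * x ^ n" by simp
    qed
    also have "rat_cong \<dots> ((\<Sum>k\<le>n. of_nat ((4 * k) choose (2 * k)) * (y / 16) ^ k) * x ^ n) p"
      by (rule rat_cong_mult_right[OF p rat_cong_sym[OF p central_binomial_sum_cong[OF p m _ y]]
            p_integers_power[OF p x]]) simp
    finally show "rat_cong (\<Sum>k=0..p div 4. of_nat ((4 * k) choose (2 * k)) * (x / 16) ^ k)
                     (x ^ ((p - 1) div 4) *
                        (\<Sum>k=0..p div 4. of_nat ((4 * k) choose (2 * k)) * (1 / (16 * x) ^ k)))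
                     p"
      unfolding dv inv_eq y_def atLeast0AtMost by (simp only: mult.commute)
  next
    assume "p mod 4 = 3"
    then obtain n where n: "p = 4 * n + 3" by (metis mult_div_mod_eq)
    hence m: "p = 2 * (2 * n + 1) + 1" and dv: "p div 4 = n" "(p - 3) div 4 = n" by simp_all
    define u where "u = 1 / (1 - x)"
    \<comment> \<open>As \<open>x\<close> is not congruent to 1, \<open>1 - x\<close> is invertible
      mod \<open>p\<close>, so \<open>u\<close> is p-integral.\<close>
    have "\<not> rat_cong (1 - x) 0 p"
    proof
      assume "rat_cong (1 - x) 0 p"
      from rat_cong_add[OF p this rat_cong_refl[OF p x]]
      have "rat_cong 1 x p" by simp
      thus False using rat_cong_sym[OF p] assms(5) by blast
    qed
    hence u: "u \<in> p_integers p"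
      using p_integers_inverse[OF p p_integers_diff[OF p p_integers_1[OF p] x]]
      by (simp add: u_def inverse_eq_divide)
    have y1: "y \<noteq> 1" using x1 x0 by (simp add: y_def)
    \<comment> \<open>This relation turns \<open>(- y) ^ k * (1 - y) ^ (n - k)\<close> into
      \<open>u ^ k * (1 - y) ^ n\<close>, which produces the argument \<open>1 / (1 - x)\<close> and
      the outer power of \<open>1 - 1 / x\<close>.\<close>
    have uy: "u * (1 - y) = - y" using x0 x1 by (simp add: u_def y_def field_simps)
    have "rat_cong (\<Sum>k\<le>n. of_nat ((4 * k) choose (2 * k)) * (y / 16) ^ k)
        (\<Sum>k\<le>n. of_nat ((2 * n + 1) choose (2 * k)) * y ^ k) p"
      by (rule central_binomial_sum_cong[OF p m _ y]) simp
    also have "rat_cong (\<Sum>k\<le>n. of_nat ((2 * n + 1) choose (2 * k)) * y ^ k)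
        (\<Sum>j\<le>n. (-4) ^ j * of_nat ((n + j) choose (2 * j)) * y ^ j) p"
    proof (intro rat_cong_sum[OF p])
      fix j assume "j \<in> {..n}"
      hence "2 * j < p" using n by simp
      from rat_cong_mult_right[OF p rat_cong_of_int[OF p binomial_centered_cong[OF p n this]]
          p_integers_power[OF p y, of j]]
      show "rat_cong (of_nat ((2 * n + 1) choose (2 * j)) * y ^ j)
          ((-4) ^ j * of_nat ((n + j) choose (2 * j)) * y ^ j) p"
        by (simp del: binomial_Suc_Suc)
    qed
    also have "(\<Sum>j\<le>n. (-4) ^ j * of_nat ((n + j) choose (2 * j)) * y ^ j)
        = (\<Sum>k\<le>n. of_nat ((2 * n + 1) choose (2 * k)) * (- y) ^ k * (1 - y) ^ (n - k))"
      using sum_even_binomials_eq[OF y1] by simp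
    also have "\<dots> = (\<Sum>k\<le>n. of_nat ((2 * n + 1) choose (2 * k)) * u ^ k) * (1 - y) ^ n"
      unfolding sum_distrib_right
    proof (intro sum.cong refl)
      fix k assume "k \<in> {..n}"
      hence "(1 - y) ^ n = (1 - y) ^ k * (1 - y) ^ (n - k)" by (simp flip: power_add)
      thus "of_nat ((2 * n + 1) choose (2 * k)) * (- y) ^ k * (1 - y) ^ (n - k)
          = of_nat ((2 * n + 1) choose (2 * k)) * u ^ k * (1 - y) ^ n"
        unfolding uy[symmetric] power_mult_distrib by (simp only: ac_simps)
    qed
    \<comment> \<open>The first reduction is now read backwards, at \<open>u\<close> in place of
      \<open>y\<close>.\<close>
    also have "rat_cong \<dots> ((\<Sum>k\<le>n. of_nat ((4 * k) choose (2 * k)) * (u / 16) ^ k) * (1 - y) ^ n) p"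
      by (rule rat_cong_mult_right[OF p rat_cong_sym[OF p central_binomial_sum_cong[OF p m _ u]]
            p_integers_power[OF p p_integers_diff[OF p p_integers_1[OF p] y]]]) simp
    finally show "rat_cong (\<Sum>k=0..p div 4. of_nat ((4 * k) choose (2 * k)) * (1 / (16 * x) ^ k))
                     ((1 - 1 / x) ^ ((p - 3) div 4) *
                        (\<Sum>k=0..p div 4. of_nat ((4 * k) choose (2 * k)) * (1 / (16 * (1 - x)) ^ k)))
                     p"
      unfolding dv inv_eq y_def u_def atLeast0AtMost by (simp only: mult.commute)
  qed
qed

end
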